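(* Consider the Curie–Weiss model $\sigma^\beta_{[n]}$ on $K_n$ at external field $h=0$ and $\beta\le\beta_c=1$. (1) For $\beta<\beta_c$, there exists a positive constant $C_\beta$ such that, for all large enough $n$, $$\mathsf H(\sigma^\beta_{[n]})\ge n-C_\beta.$$ (2) For $\beta=\beta_c$, we have $$\mathsf H(\sigma^{\beta_c}_{[n]})\ge n-C\sqrt n,$$ with an absolute constant $C<\infty$.
   Context: $\sigma^\beta_{[n]}$ is a random element of $\{-1,1\}^{[n]}$ with $\mathbb P[\sigma]\propto\exp\big(\frac{\beta}{n}\sum_{\{x,y\}\subseteq[n],\,x\ne y}\sigma_x\sigma_y\big)$, the sum being over the $\binom n2$ unordered pairs. $\mathsf H(Z)=-\sum_z\mathbb P[Z=z]\log_2\mathbb P[Z=z]$ is Shannon entropy in base $2$. *)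

theory Defs
  imports "HOL-Probability.Probability"
begin

text \<open>Spin configurations on the vertex set \<open>{1..n}\<close> (extensional functions, so that there are
  exactly \<open>2 ^ n\<close> of them).\<close>

definition spin_configs :: "nat \<Rightarrow> (nat \<Rightarrow> real) set" where
  "spin_configs n = {1..n} \<rightarrow>\<^sub>E {-1, 1}"

text \<open>The interaction energy ranges over the unordered pairs \<open>e = {x, y}\<close>, each counted once;
  \<open>\<Prod>x\<in>e. \<sigma> x\<close> is then \<open>\<sigma> x * \<sigma> y\<close>.\<close>

definition cw_weight :: "real \<Rightarrow> nat \<Rightarrow> (nat \<Rightarrow> real) \<Rightarrow> real" where
  "cw_weight \<beta> n \<sigma> = exp (\<beta> / real n * (\<Sum>e\<in>{e. e \<subseteq> {1..n} \<and> card e = 2}. \<Prod>x\<in>e. \<sigma> x))"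

definition cw_partition :: "real \<Rightarrow> nat \<Rightarrow> real" where
  "cw_partition \<beta> n = (\<Sum>\<sigma>\<in>spin_configs n. cw_weight \<beta> n \<sigma>)"

definition curie_weiss :: "real \<Rightarrow> nat \<Rightarrow> (nat \<Rightarrow> real) measure" where
  "curie_weiss \<beta> n =
     point_measure (spin_configs n) (\<lambda>\<sigma>. ennreal (cw_weight \<beta> n \<sigma> / cw_partition \<beta> n))"

text \<open>The entropy in bits of a discrete random variable \<open>X\<close> on \<open>M\<close>; for finite range, the usual
  formula is \<open>shannon_entropy_eq\<close> below.\<close>

definition shannon_entropy :: "'a measure \<Rightarrow> ('a \<Rightarrow> 'b) \<Rightarrow> real" where
  "shannon_entropy M X = prob_space.entropy M 2 (count_space (X ` space M)) X"

lemma shannon_entropy_eq: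
  assumes "prob_space M" "simple_function M X"
  shows "shannon_entropy M X =
    - (\<Sum>z\<in>X ` space M. measure M {\<omega> \<in> space M. X \<omega> = z} * log 2 (measure M {\<omega> \<in> space M. X \<omega> = z}))"
proof -
  interpret prob_space M by fact
  interpret information_space M 2 by unfold_locales simp
  have "simple_distributed M X (\<lambda>z. measure M {\<omega> \<in> space M. X \<omega> = z})"
    using assms(2) by (intro simple_distributedI) (auto intro!: arg_cong[where f = prob])
  from entropy_simple_distributed[OF this] show ?thesis
    by (simp add: shannon_entropy_def)
qed

lemma finite_spin_configs [simp]: "finite (spin_configs n)"
  by (simp add: spin_configs_def finite_PiE)

lemma cw_partition_pos: "cw_partition \<beta> n > 0"
proof -
  have "spin_configs n \<noteq> {}"
    by (simp add: spin_configs_def PiE_eq_empty_iff)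
  then show ?thesis
    unfolding cw_partition_def by (intro sum_pos) (auto simp: cw_weight_def)
qed

lemma space_curie_weiss [simp]: "space (curie_weiss \<beta> n) = spin_configs n"
  by (simp add: curie_weiss_def space_point_measure)

lemma prob_space_curie_weiss: "prob_space (curie_weiss \<beta> n)"
  unfolding curie_weiss_def
proof (rule prob_space_point_measure)
  show "(\<Sum>\<sigma>\<in>spin_configs n. ennreal (cw_weight \<beta> n \<sigma> / cw_partition \<beta> n)) = 1"
    using cw_partition_pos[of \<beta> n]
    by (subst sum_ennreal)
       (auto simp: cw_weight_def[of \<beta> n] simp flip: sum_divide_distrib
             simp: cw_partition_def cw_weight_def)
qed auto

lemma measure_curie_weiss:
  assumes "\<sigma> \<in> spin_configs n"
  shows "measure (curie_weiss \<beta> n) {\<sigma>} = cw_weight \<beta> n \<sigma> / cw_partition \<beta> n"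
proof -
  have "cw_weight \<beta> n \<sigma> / cw_partition \<beta> n \<ge> 0"
    using cw_partition_pos[of \<beta> n] by (simp add: cw_weight_def)
  then show ?thesis
    using assms by (simp add: curie_weiss_def measure_def emeasure_point_measure_finite)
qed

lemma shannon_entropy_curie_weiss:
  "shannon_entropy (curie_weiss \<beta> n) (\<lambda>\<sigma>. \<sigma>) =
    - (\<Sum>\<sigma>\<in>spin_configs n. measure (curie_weiss \<beta> n) {\<sigma>} * log 2 (measure (curie_weiss \<beta> n) {\<sigma>}))"
proof -
  have "simple_function (curie_weiss \<beta> n) (\<lambda>\<sigma>. \<sigma>)"
    unfolding curie_weiss_def by (simp add: simple_function_point_measure)
  from shannon_entropy_eq[OF prob_space_curie_weiss this] show ?thesis
    by (auto intro!: sum.cong arg_cong2[where f = "(*)"] arg_cong[where f = "log 2"]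
        arg_cong[where f = "measure (curie_weiss \<beta> n)"])
qed

end

theory Submission
  imports Defs
begin

text \<open>Write \<open>S\<close> for the total spin and \<open>m\<^sub>i = S - \<sigma>\<^sub>i\<close>. The energy is \<open>U = (S\<^sup>2 - n) / 2\<close>, and
  \<open>H ln 2 = ln Z - (\<beta> / n) E U\<close>; since \<open>U\<close> has mean zero under the uniform measure,
  \<open>Z \<ge> 2 ^ n\<close>, so only an upper bound on \<open>E S\<^sup>2\<close> is needed (for \<open>\<beta> < 0\<close>, only
  \<open>E S\<^sup>2 \<ge> 0\<close>). Given the other spins, \<open>\<sigma>\<^sub>i\<close> has mean
  \<open>tanh (\<beta> m\<^sub>i / n)\<close>, whence \<open>E S\<^sup>2 - n = (\<Sum>i. E (m\<^sub>i tanh (\<beta> m\<^sub>i / n)))\<close>. For \<open>0 \<le> \<beta> < 1\<close> the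
  bound \<open>x tanh (\<beta> x) \<le> \<beta> x\<^sup>2\<close> gives \<open>E S\<^sup>2 = O(n)\<close>. For \<open>\<beta> = 1\<close> the quadratic terms cancel, and
  the quartic correction in \<open>x tanh x \<le> x\<^sup>2 - x\<^sup>4 / 12\<close> bounds the fourth moments of the \<open>m\<^sub>i\<close>, so
  that \<open>E S\<^sup>2 = O(n powr (3/2))\<close>.\<close>

section \<open>Polynomial bounds on the hyperbolic tangent\<close>

lemma tanh_le_self:
  fixes x :: real
  assumes "0 \<le> x"
  shows "tanh x \<le> x"
proof -
  have "0 - tanh 0 \<le> x - tanh x"
  proof (rule DERIV_nonneg_imp_nondecreasing[OF assms, where f = "\<lambda>x. x - tanh x"])
    fix t :: real
    show "\<exists>y. ((\<lambda>x. x - tanh x) has_real_derivative y) (at t) \<and> 0 \<le> y"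
      by (rule exI[of _ "(tanh t)\<^sup>2"]) (auto intro!: derivative_eq_intros)
  qed
  then show ?thesis by simp
qed

text \<open>Since tanh t <= t, the derivative 1 - tanh^2 is at least 1 - t^2, so tanh x >= x -
  x^3/3; on the unit interval x^3 <= x. This crude lower bound is what \<open>tanh_le_cubic\<close>
  feeds back into the derivative.\<close>

lemma half_le_tanh:
  fixes x :: real
  assumes "0 \<le> x" "x \<le> 1"
  shows "x / 2 \<le> tanh x"
proof -
  have "tanh 0 - (0 - 0 ^ 3 / 3) \<le> tanh x - (x - x ^ 3 / 3)"
  proof (rule DERIV_nonneg_imp_nondecreasing[OF assms(1), where f = "\<lambda>x. tanh x - (x - x ^ 3 / 3)"])
    fix t :: real
    assume t: "0 \<le> t"
    have "(tanh t)\<^sup>2 \<le> t\<^sup>2"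
      using t tanh_le_self[OF t] by (intro power_mono) auto
    then show "\<exists>y. ((\<lambda>x. tanh x - (x - x ^ 3 / 3)) has_real_derivative y) (at t) \<and> 0 \<le> y"
      by (intro exI[of _ "t\<^sup>2 - (tanh t)\<^sup>2"]) (auto intro!: derivative_eq_intros)
  qed
  moreover have "x ^ 3 \<le> x"
    using power_decreasing[of 1 3 x] assms by simp
  ultimately show ?thesis using assms by simp
qed

text \<open>By \<open>half_le_tanh\<close> the derivative 1 - tanh^2 is at most 1 - t^2/4, and
  integrating t^2/4 produces the 12.\<close>

lemma tanh_le_cubic:
  fixes x :: real
  assumes "0 \<le> x" "x \<le> 1"
  shows "tanh x \<le> x - x ^ 3 / 12"
proof -
  have "(0 - 0 ^ 3 / 12) - tanh 0 \<le> (x - x ^ 3 / 12) - tanh x"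
  proof (rule DERIV_nonneg_imp_nondecreasing[OF assms(1), where f = "\<lambda>x. (x - x ^ 3 / 12) - tanh x"])
    fix t :: real
    assume t: "0 \<le> t" "t \<le> x"
    have "(t / 2)\<^sup>2 \<le> (tanh t)\<^sup>2"
      using t half_le_tanh[of t] assms by (intro power_mono) auto
    then show "\<exists>y. ((\<lambda>x. (x - x ^ 3 / 12) - tanh x) has_real_derivative y) (at t) \<and> 0 \<le> y"
      by (intro exI[of _ "(tanh t)\<^sup>2 - (t / 2)\<^sup>2"])
         (auto intro!: derivative_eq_intros simp: power2_eq_square)
  qed
  then show ?thesis by simp
qed

lemma mult_tanh_abs: "x * tanh x = \<bar>x\<bar> * tanh \<bar>x\<bar>" for x :: real
  by (cases "x \<ge> 0") auto

lemma mult_tanh_le_square: "x * tanh x \<le> x\<^sup>2" for x :: real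
proof -
  have "\<bar>x\<bar> * tanh \<bar>x\<bar> \<le> \<bar>x\<bar> * \<bar>x\<bar>"
    by (intro mult_left_mono tanh_le_self) auto
  then show ?thesis by (simp add: mult_tanh_abs[of x] power2_eq_square)
qed

lemma mult_tanh_le_quartic:
  fixes x :: real
  assumes "\<bar>x\<bar> \<le> 1"
  shows "x * tanh x \<le> x\<^sup>2 - x ^ 4 / 12"
proof -
  have "\<bar>x\<bar> * tanh \<bar>x\<bar> \<le> \<bar>x\<bar> * (\<bar>x\<bar> - \<bar>x\<bar> ^ 3 / 12)"
    using assms by (intro mult_left_mono tanh_le_cubic) auto
  also have "\<dots> = \<bar>x\<bar> ^ 2 - \<bar>x\<bar> ^ 4 / 12"
    by (simp add: algebra_simps power2_eq_square eval_nat_numeral)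
  finally show ?thesis by (simp add: mult_tanh_abs[of x])
qed

section \<open>The energy in terms of the total spin and of the local fields\<close>

text \<open>Induction on \<open>A\<close>: a new point \<open>a\<close> adds exactly the pairs
  \<open>{a, y}\<close> with \<open>y\<close> in \<open>A\<close>, whose products sum to the cross
  term in the expanded square.\<close>

lemma sum_pairs_prod:
  fixes f :: "'a \<Rightarrow> 'b::comm_ring_1"
  assumes "finite A"
  shows "2 * (\<Sum>e\<in>{e. e \<subseteq> A \<and> card e = 2}. \<Prod>x\<in>e. f x) = (\<Sum>x\<in>A. f x)\<^sup>2 - (\<Sum>x\<in>A. (f x)\<^sup>2)"
  using assms
proof (induction A)
  case empty
  have "{e. e \<subseteq> {} \<and> card e = 2} = ({} :: 'a set set)" by auto
  then show ?case by (simp only:) simp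
next
  case (insert a A)
  let ?P = "\<lambda>A. {e. e \<subseteq> A \<and> card e = 2}"
  have split: "?P (insert a A) = ?P A \<union> (\<lambda>y. {a, y}) ` A"
  proof (intro subset_antisym subsetI)
    fix e assume e: "e \<in> ?P (insert a A)"
    then obtain x y where xy: "e = {x, y}" "x \<noteq> y" by (auto simp: card_2_iff)
    show "e \<in> ?P A \<union> (\<lambda>y. {a, y}) ` A"
    proof (cases "a \<in> e")
      case True
      then have "e = {a, x} \<and> x \<noteq> a \<or> e = {a, y} \<and> y \<noteq> a" using xy by auto
      then show ?thesis using e by blast
    next
      case False
      then show ?thesis using e by auto
    qed
  next
    fix e assume "e \<in> ?P A \<union> (\<lambda>y. {a, y}) ` A"
    then show "e \<in> ?P (insert a A)" using insert.hyps by (auto simp: card_2_iff)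
  qed
  have inj: "inj_on (\<lambda>y. {a, y}) A" using insert.hyps by (auto simp: inj_on_def doubleton_eq_iff)
  have "(\<Sum>e\<in>?P (insert a A). \<Prod>x\<in>e. f x) =
      (\<Sum>e\<in>?P A. \<Prod>x\<in>e. f x) + (\<Sum>e\<in>(\<lambda>y. {a, y}) ` A. \<Prod>x\<in>e. f x)"
    unfolding split using insert.hyps by (intro sum.union_disjoint) auto
  also have "(\<Sum>e\<in>(\<lambda>y. {a, y}) ` A. \<Prod>x\<in>e. f x) = (\<Sum>y\<in>A. f a * f y)"
    unfolding sum.reindex[OF inj] o_def
  proof (rule sum.cong[OF refl])
    fix y assume "y \<in> A"
    then have "a \<noteq> y" using insert.hyps by auto
    then show "(\<Prod>x\<in>{a, y}. f x) = f a * f y" by simp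
  qed
  also have "\<dots> = f a * (\<Sum>y\<in>A. f y)" by (rule sum_distrib_left[symmetric])
  finally show ?case
    using insert.IH insert.hyps by (simp add: algebra_simps power2_eq_square)
qed

definition total_spin :: "nat \<Rightarrow> (nat \<Rightarrow> real) \<Rightarrow> real" where
  "total_spin n \<sigma> = (\<Sum>i\<in>{1..n}. \<sigma> i)"

definition cw_energy :: "nat \<Rightarrow> (nat \<Rightarrow> real) \<Rightarrow> real" where
  "cw_energy n \<sigma> = ((total_spin n \<sigma>)\<^sup>2 - real n) / 2"

text \<open>For a site \<open>i\<close> in \<open>{1..n}\<close> this is, up to the factor
  \<open>\<beta> / n\<close>, the field that the remaining spins exert on \<open>i\<close>.\<close>

definition other_spin :: "nat \<Rightarrow> nat \<Rightarrow> (nat \<Rightarrow> real) \<Rightarrow> real" where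
  "other_spin n i \<sigma> = total_spin n \<sigma> - \<sigma> i"

lemma spin_square:
  assumes "\<sigma> \<in> spin_configs n" "i \<in> {1..n}"
  shows "(\<sigma> i)\<^sup>2 = 1"
  using assms PiE_mem[of \<sigma> "{1..n}" "\<lambda>_. {-1, 1}" i] by (auto simp: spin_configs_def)

lemma cw_weight_eq:
  assumes "\<sigma> \<in> spin_configs n"
  shows "cw_weight \<beta> n \<sigma> = exp (\<beta> / real n * cw_energy n \<sigma>)"
proof -
  have "(\<Sum>i\<in>{1..n}. (\<sigma> i)\<^sup>2) = (\<Sum>i\<in>{1..n}. 1)"
    by (rule sum.cong[OF refl]) (rule spin_square[OF assms])
  then have "(\<Sum>e\<in>{e. e \<subseteq> {1..n} \<and> card e = 2}. \<Prod>x\<in>e. \<sigma> x) = cw_energy n \<sigma>"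
    using sum_pairs_prod[of "{1..n}" \<sigma>] by (simp add: cw_energy_def total_spin_def)
  then show ?thesis by (simp only: cw_weight_def)
qed

lemma cw_weight_pos: "cw_weight \<beta> n \<sigma> > 0"
  by (simp add: cw_weight_def)

text \<open>Places \<open>other_spin n i \<sigma> / n\<close> in the range where the quartic bound
  on x tanh x holds.\<close>

lemma abs_other_spin_le:
  assumes "\<sigma> \<in> spin_configs n" "i \<in> {1..n}"
  shows "\<bar>other_spin n i \<sigma>\<bar> \<le> real n"
proof -
  have "other_spin n i \<sigma> = (\<Sum>j\<in>{1..n} - {i}. \<sigma> j)"
    using assms(2) by (simp add: other_spin_def total_spin_def sum_diff1)
  also have "\<bar>\<dots>\<bar> \<le> (\<Sum>j\<in>{1..n} - {i}. \<bar>\<sigma> j\<bar>)" by (rule sum_abs)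
  also have "\<dots> \<le> (\<Sum>j\<in>{1..n} - {i}. 1)"
    using spin_square[OF assms(1)] by (intro sum_mono) (auto simp: abs_square_eq_1 power2_eq_1_iff)
  also have "\<dots> \<le> real n" using assms(2) by simp
  finally show ?thesis .
qed

lemma sum_spin_mult_other_spin:
  assumes "\<sigma> \<in> spin_configs n"
  shows "(\<Sum>i\<in>{1..n}. \<sigma> i * other_spin n i \<sigma>) = (total_spin n \<sigma>)\<^sup>2 - real n"
proof -
  have "(\<Sum>i\<in>{1..n}. \<sigma> i * other_spin n i \<sigma>) = (\<Sum>i\<in>{1..n}. \<sigma> i * total_spin n \<sigma> - 1)"
    using spin_square[OF assms]
    by (intro sum.cong refl) (auto simp: other_spin_def algebra_simps power2_eq_square)
  also have "\<dots> = (\<Sum>i\<in>{1..n}. \<sigma> i) * total_spin n \<sigma> - real n"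
    by (simp add: sum_subtractf sum_distrib_right)
  finally show ?thesis by (simp add: total_spin_def power2_eq_square)
qed

text \<open>In the expansion of each square the spin contributes 1, and the cross terms add up to -2
  times the squared total spin.\<close>

lemma sum_other_spin_square:
  assumes "\<sigma> \<in> spin_configs n"
  shows "(\<Sum>i\<in>{1..n}. (other_spin n i \<sigma>)\<^sup>2) = (real n - 2) * (total_spin n \<sigma>)\<^sup>2 + real n"
proof -
  have "(\<Sum>i\<in>{1..n}. (other_spin n i \<sigma>)\<^sup>2) =
      (\<Sum>i\<in>{1..n}. (total_spin n \<sigma>)\<^sup>2 + 1 - \<sigma> i * (2 * total_spin n \<sigma>))"
    using spin_square[OF assms]
    by (intro sum.cong refl) (auto simp: other_spin_def power2_diff)
  also have "\<dots> = real n * ((total_spin n \<sigma>)\<^sup>2 + 1) - (\<Sum>i\<in>{1..n}. \<sigma> i) * (2 * total_spin n \<sigma>)"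
    by (simp add: sum_subtractf sum_distrib_right)
  finally show ?thesis by (simp add: total_spin_def power2_eq_square algebra_simps)
qed

section \<open>Single spin flips and the conditional mean of a spin\<close>

definition flip_spin :: "nat \<Rightarrow> (nat \<Rightarrow> real) \<Rightarrow> nat \<Rightarrow> real" where
  "flip_spin i \<sigma> = \<sigma>(i := - \<sigma> i)"

lemma flip_spin_flip_spin [simp]: "flip_spin i (flip_spin i \<sigma>) = \<sigma>"
  by (simp add: flip_spin_def)

lemma flip_spin_same [simp]: "flip_spin i \<sigma> i = - \<sigma> i"
  by (simp add: flip_spin_def)

lemma flip_spin_in_spin_configs:
  assumes "\<sigma> \<in> spin_configs n" "i \<in> {1..n}"
  shows "flip_spin i \<sigma> \<in> spin_configs n"
  using assms by (auto simp: spin_configs_def flip_spin_def PiE_iff extensional_def)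

lemma sum_flip_spin:
  assumes "i \<in> {1..n}"
  shows "(\<Sum>\<sigma>\<in>spin_configs n. f (flip_spin i \<sigma>)) = (\<Sum>\<sigma>\<in>spin_configs n. f \<sigma>)"
  using assms flip_spin_in_spin_configs
  by (intro sum.reindex_bij_witness[where i = "flip_spin i" and j = "flip_spin i"]) auto

lemma other_spin_flip_spin:
  assumes "i \<in> {1..n}"
  shows "other_spin n i (flip_spin i \<sigma>) = other_spin n i \<sigma>"
proof -
  have *: "other_spin n i \<tau> = (\<Sum>j\<in>{1..n} - {i}. \<tau> j)" for \<tau>
    using assms by (simp add: other_spin_def total_spin_def sum_diff1)
  show ?thesis unfolding * by (intro sum.cong) (auto simp: flip_spin_def)
qed

lemma cw_energy_other_spin:
  assumes "\<sigma> \<in> spin_configs n" "i \<in> {1..n}"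
  shows "cw_energy n \<sigma> = ((other_spin n i \<sigma>)\<^sup>2 + 1 - real n) / 2 + \<sigma> i * other_spin n i \<sigma>"
  using spin_square[OF assms] by (simp add: cw_energy_def other_spin_def power2_eq_square field_simps)

text \<open>Both sides equal 1 / cosh a.\<close>

lemma exp_mult_one_minus_tanh: "exp a * (1 - tanh a) = exp (- a) * (1 + tanh a)" for a :: real
  using cosh_real_pos[of a]
  by (simp add: tanh_def sinh_def cosh_def field_simps)

text \<open>Callen's identity, with \<open>g\<close> standing for any function of the local field.
  The difference of the two summands changes sign when spin \<open>i\<close> is flipped, and
  flipping permutes the configurations.\<close>

lemma conditional_mean_spin:
  assumes "i \<in> {1..n}"
  shows "(\<Sum>\<sigma>\<in>spin_configs n. cw_weight \<beta> n \<sigma> * (\<sigma> i * g (other_spin n i \<sigma>))) =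
    (\<Sum>\<sigma>\<in>spin_configs n. cw_weight \<beta> n \<sigma> * (tanh (\<beta> * other_spin n i \<sigma> / real n) * g (other_spin n i \<sigma>)))"
proof -
  define h where "h \<sigma> = cw_weight \<beta> n \<sigma> *
    ((\<sigma> i - tanh (\<beta> * other_spin n i \<sigma> / real n)) * g (other_spin n i \<sigma>))" for \<sigma>
  have anti: "h (flip_spin i \<sigma>) = - h \<sigma>" if \<sigma>: "\<sigma> \<in> spin_configs n" for \<sigma>
  proof -
    define a where "a = \<beta> * other_spin n i \<sigma> / real n"
    \<comment> \<open>\<open>r\<close> is the factor of the weight that a flip at \<open>i\<close>
      leaves unchanged; the other factor is \<open>exp (\<sigma> i * a)\<close>.\<close>
    define r where "r = exp (\<beta> / real n * (((other_spin n i \<sigma>)\<^sup>2 + 1 - real n) / 2))"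
    have w: "cw_weight \<beta> n \<sigma> = r * exp (\<sigma> i * a)"
      unfolding r_def a_def cw_weight_eq[OF \<sigma>] cw_energy_other_spin[OF \<sigma> assms] exp_add[symmetric]
      by (simp add: algebra_simps)
    have w': "cw_weight \<beta> n (flip_spin i \<sigma>) = r * exp (- \<sigma> i * a)"
      unfolding r_def a_def cw_weight_eq[OF flip_spin_in_spin_configs[OF \<sigma> assms]]
        cw_energy_other_spin[OF flip_spin_in_spin_configs[OF \<sigma> assms] assms]
        other_spin_flip_spin[OF assms] exp_add[symmetric]
      by (simp add: algebra_simps)
    \<comment> \<open>For spin 1 and for spin -1 alike this is
      \<open>exp_mult_one_minus_tanh\<close>.\<close>
    have "exp (- \<sigma> i * a) * (- \<sigma> i - tanh a) = - (exp (\<sigma> i * a) * (\<sigma> i - tanh a))"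
      using spin_square[OF \<sigma> assms] exp_mult_one_minus_tanh[of a]
      by (auto simp: power2_eq_1_iff algebra_simps)
    then have "r * g (other_spin n i \<sigma>) * (exp (- \<sigma> i * a) * (- \<sigma> i - tanh a)) =
        r * g (other_spin n i \<sigma>) * - (exp (\<sigma> i * a) * (\<sigma> i - tanh a))"
      by (rule arg_cong)
    then show ?thesis
      unfolding h_def w w' other_spin_flip_spin[OF assms] a_def[symmetric]
      by (simp add: algebra_simps)
  qed
  have "(\<Sum>\<sigma>\<in>spin_configs n. h \<sigma>) = (\<Sum>\<sigma>\<in>spin_configs n. h (flip_spin i \<sigma>))"
    by (simp add: sum_flip_spin[OF assms])
  also have "\<dots> = - (\<Sum>\<sigma>\<in>spin_configs n. h \<sigma>)"
    by (simp add: anti sum_negf)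
  finally have "(\<Sum>\<sigma>\<in>spin_configs n. h \<sigma>) = 0" by simp
  then show ?thesis
    by (simp add: h_def algebra_simps sum_subtractf)
qed

section \<open>Expectations under the model\<close>

text \<open>A finite weighted sum instead of an integral, so that linearity and monotonicity need no
  integrability.\<close>

definition cw_mean :: "real \<Rightarrow> nat \<Rightarrow> ((nat \<Rightarrow> real) \<Rightarrow> real) \<Rightarrow> real" where
  "cw_mean \<beta> n f = (\<Sum>\<sigma>\<in>spin_configs n. cw_weight \<beta> n \<sigma> * f \<sigma>) / cw_partition \<beta> n"

lemma cw_mean_mono:
  assumes "\<And>\<sigma>. \<sigma> \<in> spin_configs n \<Longrightarrow> f \<sigma> \<le> g \<sigma>"
  shows "cw_mean \<beta> n f \<le> cw_mean \<beta> n g"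
  unfolding cw_mean_def using assms cw_partition_pos[of \<beta> n]
  by (intro divide_right_mono sum_mono mult_left_mono) (auto simp: cw_weight_def)

lemma cw_mean_cong:
  assumes "\<And>\<sigma>. \<sigma> \<in> spin_configs n \<Longrightarrow> f \<sigma> = g \<sigma>"
  shows "cw_mean \<beta> n f = cw_mean \<beta> n g"
  by (intro antisym cw_mean_mono) (simp_all add: assms)

lemma cw_mean_add: "cw_mean \<beta> n (\<lambda>\<sigma>. f \<sigma> + g \<sigma>) = cw_mean \<beta> n f + cw_mean \<beta> n g"
  by (simp add: cw_mean_def distrib_left sum.distrib add_divide_distrib)

lemma cw_mean_cmult: "cw_mean \<beta> n (\<lambda>\<sigma>. c * f \<sigma>) = c * cw_mean \<beta> n f"
  by (simp add: cw_mean_def sum_distrib_left mult.left_commute)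

lemma cw_mean_const: "cw_mean \<beta> n (\<lambda>_. c) = c"
  using cw_partition_pos[of \<beta> n]
  by (simp add: cw_mean_def cw_partition_def flip: sum_distrib_right)

lemma cw_mean_sum: "cw_mean \<beta> n (\<lambda>\<sigma>. \<Sum>i\<in>A. f i \<sigma>) = (\<Sum>i\<in>A. cw_mean \<beta> n (f i))"
  unfolding cw_mean_def sum_distrib_left
  by (subst sum.swap) (simp add: sum_divide_distrib)

section \<open>Second moment of the total spin\<close>

lemma cw_mean_total_spin_square:
  "cw_mean \<beta> n (\<lambda>\<sigma>. (total_spin n \<sigma>)\<^sup>2) - real n =
    cw_mean \<beta> n (\<lambda>\<sigma>. \<Sum>i\<in>{1..n}. other_spin n i \<sigma> * tanh (\<beta> * other_spin n i \<sigma> / real n))"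
proof -
  \<comment> \<open>The difference is written as a sum to match \<open>cw_mean_add\<close>.\<close>
  have "cw_mean \<beta> n (\<lambda>\<sigma>. (total_spin n \<sigma>)\<^sup>2) - real n = cw_mean \<beta> n (\<lambda>\<sigma>. (total_spin n \<sigma>)\<^sup>2 + - real n)"
    by (simp add: cw_mean_add cw_mean_const del: add_uminus_conv_diff)
  also have "\<dots> = cw_mean \<beta> n (\<lambda>\<sigma>. \<Sum>i\<in>{1..n}. \<sigma> i * other_spin n i \<sigma>)"
    by (rule cw_mean_cong) (simp only: sum_spin_mult_other_spin add_uminus_conv_diff)
  also have "\<dots> = (\<Sum>i\<in>{1..n}. cw_mean \<beta> n (\<lambda>\<sigma>. \<sigma> i * other_spin n i \<sigma>))"
    by (rule cw_mean_sum)
  also have "\<dots> = (\<Sum>i\<in>{1..n}. cw_mean \<beta> n (\<lambda>\<sigma>. other_spin n i \<sigma> * tanh (\<beta> * other_spin n i \<sigma> / real n)))"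
    using conditional_mean_spin[where g = "\<lambda>x. x" and n = n and \<beta> = \<beta>]
    by (intro sum.cong refl) (simp add: cw_mean_def mult.commute mult.left_commute)
  finally show ?thesis by (simp add: cw_mean_sum)
qed

text \<open>The moment bounds itself: \<open>?E - n\<close> is at most
  \<open>\<beta> * ?E + \<beta>\<close>, which can be solved for \<open>?E\<close> because
  \<open>\<beta> < 1\<close>.\<close>

lemma cw_mean_total_spin_square_high_temperature:
  assumes "0 \<le> \<beta>" "\<beta> < 1" "n \<ge> 1"
  shows "cw_mean \<beta> n (\<lambda>\<sigma>. (total_spin n \<sigma>)\<^sup>2) \<le> 2 * real n / (1 - \<beta>)"
proof -
  let ?E = "cw_mean \<beta> n (\<lambda>\<sigma>. (total_spin n \<sigma>)\<^sup>2)"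
  have "?E - real n \<le> cw_mean \<beta> n (\<lambda>\<sigma>. \<beta> * (total_spin n \<sigma>)\<^sup>2 + \<beta>)"
    unfolding cw_mean_total_spin_square
  proof (rule cw_mean_mono)
    fix \<sigma> assume \<sigma>: "\<sigma> \<in> spin_configs n"
    have *: "x * tanh (\<beta> * x / real n) \<le> \<beta> / real n * x\<^sup>2" for x
    proof (cases "\<beta> = 0")
      case False
      then have "\<beta> / real n > 0" using assms by simp
      \<comment> \<open>This is y tanh y <= y^2 at \<open>y = \<beta> * x / n\<close>; cancelling
        the common factor requires it to be positive, hence the case split.\<close>
      moreover have "\<beta> / real n * (x * tanh (\<beta> * x / real n)) \<le> \<beta> / real n * (\<beta> / real n * x\<^sup>2)"
        using mult_tanh_le_square[of "\<beta> * x / real n"] by (simp add: power2_eq_square mult_ac)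
      ultimately show ?thesis by (simp only: mult_le_cancel_left_pos)
    qed simp
    have "(\<Sum>i\<in>{1..n}. other_spin n i \<sigma> * tanh (\<beta> * other_spin n i \<sigma> / real n)) \<le>
        (\<Sum>i\<in>{1..n}. \<beta> / real n * (other_spin n i \<sigma>)\<^sup>2)"
      by (intro sum_mono *)
    also have "\<dots> = \<beta> / real n * ((real n - 2) * (total_spin n \<sigma>)\<^sup>2 + real n)"
      by (simp only: sum_distrib_left[symmetric] sum_other_spin_square[OF \<sigma>])
    also have "\<dots> \<le> \<beta> / real n * (real n * (total_spin n \<sigma>)\<^sup>2 + real n)"
      using assms by (intro mult_left_mono add_right_mono mult_right_mono) auto
    also have "\<dots> = \<beta> * (total_spin n \<sigma>)\<^sup>2 + \<beta>"
      using assms by (simp add: field_simps)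
    finally show "(\<Sum>i\<in>{1..n}. other_spin n i \<sigma> * tanh (\<beta> * other_spin n i \<sigma> / real n)) \<le>
        \<beta> * (total_spin n \<sigma>)\<^sup>2 + \<beta>" .
  qed
  also have "\<dots> = \<beta> * ?E + \<beta>"
    by (simp add: cw_mean_add cw_mean_cmult cw_mean_const)
  \<comment> \<open>The right-hand side absorbs \<open>n + \<beta>\<close>, as
    \<open>\<beta> < 1 \<le> n\<close>.\<close>
  finally have "?E * (1 - \<beta>) \<le> 2 * real n"
    using assms by (simp add: algebra_simps)
  then show ?thesis using assms by (simp add: pos_le_divide_eq)
qed

text \<open>Two stages: the self-bounding inequality loses its second moments and leaves a bound on
  the fourth moments \<open>F\<close>; a weighted AM-GM inequality then returns to the second
  moment.\<close>

lemma cw_mean_total_spin_square_critical: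
  assumes "n \<ge> 1"
  shows "cw_mean 1 n (\<lambda>\<sigma>. (total_spin n \<sigma>)\<^sup>2) \<le> 27 * real n * sqrt (real n)"
proof -
  let ?E = "cw_mean 1 n (\<lambda>\<sigma>. (total_spin n \<sigma>)\<^sup>2)"
  define F where "F = cw_mean 1 n (\<lambda>\<sigma>. \<Sum>i\<in>{1..n}. (other_spin n i \<sigma>) ^ 4)"
  \<comment> \<open>Powers of \<open>s\<close> replace half-integer powers of \<open>n\<close>; the
    target order of \<open>?E\<close> is \<open>s ^ 3\<close>.\<close>
  define s where "s = sqrt (real n)"
  have s: "s \<ge> 1" "real n = s\<^sup>2" using assms by (auto simp: s_def)
  have "?E - real n \<le> cw_mean 1 n (\<lambda>\<sigma>. (total_spin n \<sigma>)\<^sup>2 +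
      (1 + - (1 / (12 * real n ^ 3)) * (\<Sum>i\<in>{1..n}. (other_spin n i \<sigma>) ^ 4)))"
    unfolding cw_mean_total_spin_square
  proof (rule cw_mean_mono)
    fix \<sigma> assume \<sigma>: "\<sigma> \<in> spin_configs n"
    have *: "x * tanh (1 * x / real n) \<le> 1 / real n * x\<^sup>2 - 1 / (12 * real n ^ 3) * x ^ 4"
      if "\<bar>x\<bar> \<le> real n" for x
    proof -
      have "real n * (x / real n * tanh (x / real n)) \<le> real n * ((x / real n)\<^sup>2 - (x / real n) ^ 4 / 12)"
        using that assms by (intro mult_left_mono mult_tanh_le_quartic) auto
      also have "\<dots> = 1 / real n * x\<^sup>2 - 1 / (12 * real n ^ 3) * x ^ 4"
        using assms by (simp add: field_simps eval_nat_numeral)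
      finally show ?thesis using assms by simp
    qed
    have "(\<Sum>i\<in>{1..n}. other_spin n i \<sigma> * tanh (1 * other_spin n i \<sigma> / real n)) \<le>
        (\<Sum>i\<in>{1..n}. 1 / real n * (other_spin n i \<sigma>)\<^sup>2 - 1 / (12 * real n ^ 3) * (other_spin n i \<sigma>) ^ 4)"
      by (intro sum_mono * abs_other_spin_le[OF \<sigma>])
    also have "\<dots> = 1 / real n * ((real n - 2) * (total_spin n \<sigma>)\<^sup>2 + real n) -
        1 / (12 * real n ^ 3) * (\<Sum>i\<in>{1..n}. (other_spin n i \<sigma>) ^ 4)"
      by (simp only: sum_subtractf sum_distrib_left[symmetric] sum_other_spin_square[OF \<sigma>])
    also have "\<dots> \<le> 1 / real n * (real n * (total_spin n \<sigma>)\<^sup>2 + real n) -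
        1 / (12 * real n ^ 3) * (\<Sum>i\<in>{1..n}. (other_spin n i \<sigma>) ^ 4)"
      by (intro diff_right_mono mult_left_mono add_right_mono mult_right_mono) auto
    also have "\<dots> = (total_spin n \<sigma>)\<^sup>2 +
        (1 + - (1 / (12 * real n ^ 3)) * (\<Sum>i\<in>{1..n}. (other_spin n i \<sigma>) ^ 4))"
      using assms by (simp add: distrib_left)
    finally show "(\<Sum>i\<in>{1..n}. other_spin n i \<sigma> * tanh (1 * other_spin n i \<sigma> / real n)) \<le> \<dots>" .
  qed
  also have "\<dots> = ?E + (1 + - (1 / (12 * real n ^ 3)) * F)"
    unfolding F_def cw_mean_add cw_mean_cmult cw_mean_const ..
  \<comment> \<open>\<open>?E\<close> cancels from both sides, and \<open>n + 1\<close> is at most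
    \<open>2 * n\<close>.\<close>
  finally have "1 / (12 * real n ^ 3) * F \<le> 2 * real n" using assms by simp
  then have F: "F \<le> 24 * real n ^ 4"
    using assms by (simp add: field_simps eval_nat_numeral)
  have "real n * ?E \<le> cw_mean 1 n (\<lambda>\<sigma>. 1 / s ^ 3 * (\<Sum>i\<in>{1..n}. (other_spin n i \<sigma>) ^ 4) + (s ^ 5 + 2 * real n))"
    unfolding cw_mean_cmult[symmetric]
  proof (rule cw_mean_mono)
    fix \<sigma> assume \<sigma>: "\<sigma> \<in> spin_configs n"
    have *: "(total_spin n \<sigma>)\<^sup>2 \<le> 1 / s ^ 3 * (other_spin n i \<sigma>) ^ 4 + (s ^ 3 + 2)" if i: "i \<in> {1..n}" for i
    proof -
      let ?m = "other_spin n i \<sigma>"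
      \<comment> \<open>The parallelogram identity, the total spin being
        \<open>?m + \<sigma> i\<close>.\<close>
      have "(total_spin n \<sigma>)\<^sup>2 + (?m - \<sigma> i)\<^sup>2 = 2 * ?m\<^sup>2 + 2 * (\<sigma> i)\<^sup>2"
        by (simp add: other_spin_def power2_eq_square algebra_simps)
      then have 1: "(total_spin n \<sigma>)\<^sup>2 \<le> 2 * ?m\<^sup>2 + 2"
        using spin_square[OF \<sigma> i] zero_le_power2[of "?m - \<sigma> i"] by linarith
      \<comment> \<open>AM-GM with weight \<open>s ^ 3\<close>, chosen because the bound on
        \<open>F\<close> makes the fourth moments of order \<open>s ^ 6\<close> on average over the
        sites.\<close>
      have "0 \<le> (?m\<^sup>2 - s ^ 3)\<^sup>2 / s ^ 3" using s by simp
      also have "\<dots> = 1 / s ^ 3 * ?m ^ 4 + s ^ 3 - 2 * ?m\<^sup>2"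
        using s by (simp add: field_simps eval_nat_numeral)
      finally show ?thesis using 1 by simp
    qed
    have "(\<Sum>i\<in>{1..n}. (total_spin n \<sigma>)\<^sup>2) \<le> (\<Sum>i\<in>{1..n}. 1 / s ^ 3 * (other_spin n i \<sigma>) ^ 4 + (s ^ 3 + 2))"
      by (intro sum_mono *)
    also have "\<dots> = 1 / s ^ 3 * (\<Sum>i\<in>{1..n}. (other_spin n i \<sigma>) ^ 4) + real n * (s ^ 3 + 2)"
      by (simp only: sum.distrib sum_distrib_left[symmetric]) (simp add: algebra_simps)
    also have "real n * (s ^ 3 + 2) = s ^ 5 + 2 * real n"
      using s(2) by (simp add: algebra_simps eval_nat_numeral)
    finally show "real n * (total_spin n \<sigma>)\<^sup>2 \<le>
        1 / s ^ 3 * (\<Sum>i\<in>{1..n}. (other_spin n i \<sigma>) ^ 4) + (s ^ 5 + 2 * real n)" by simp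
  qed
  also have "\<dots> = 1 / s ^ 3 * F + (s ^ 5 + 2 * real n)"
    unfolding F_def cw_mean_add cw_mean_cmult cw_mean_const ..
  \<comment> \<open>The 27 of the statement is 24 + 1 + 2, every term being brought to the order
    \<open>s ^ 5\<close>.\<close>
  also have "\<dots> \<le> 1 / s ^ 3 * (24 * s ^ 8) + (s ^ 5 + 2 * s ^ 5)"
  proof (intro add_mono mult_left_mono)
    show "F \<le> 24 * s ^ 8" using F s(2) by (simp add: power_mult[symmetric])
    show "real n \<le> s ^ 5" using power_increasing[of 2 5 s] s by simp
  qed (use s in auto)
  also have "\<dots> = real n * (27 * (real n * s))"
    using s(1) unfolding s(2) by (simp add: field_simps eval_nat_numeral)
  finally have "?E \<le> 27 * (real n * s)" using assms by simp
  then show ?thesis by (simp add: s_def)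
qed

section \<open>Lower bounds on the partition function and the entropy\<close>

lemma card_spin_configs: "card (spin_configs n) = 2 ^ n"
  by (simp add: spin_configs_def card_PiE numeral_2_eq_2)

text \<open>The second moment identity at inverse temperature 0: all weights are 1 and tanh 0 = 0,
  so the squared total spin has mean \<open>n\<close>.\<close>

lemma sum_cw_energy:
  "(\<Sum>\<sigma>\<in>spin_configs n. cw_energy n \<sigma>) = 0"
proof -
  have w: "cw_weight 0 n \<sigma> = 1" for \<sigma> by (simp add: cw_weight_def)
  have "cw_mean 0 n (\<lambda>\<sigma>. (total_spin n \<sigma>)\<^sup>2) - real n = 0"
    unfolding cw_mean_total_spin_square by (simp add: cw_mean_const)
  then have "cw_mean 0 n (\<lambda>\<sigma>. 1 / 2 * ((total_spin n \<sigma>)\<^sup>2 + - real n)) = 0"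
    unfolding cw_mean_cmult cw_mean_add cw_mean_const by simp
  then show ?thesis
    using cw_partition_pos[of 0 n] by (simp add: cw_mean_def w cw_energy_def)
qed

text \<open>Apply exp x >= 1 + x to each weight; the linear terms sum to zero by
  \<open>sum_cw_energy\<close>, whatever the sign of \<open>\<beta>\<close>.\<close>

lemma cw_partition_ge: "cw_partition \<beta> n \<ge> 2 ^ n"
proof -
  have "(2 :: real) ^ n = (\<Sum>\<sigma>\<in>spin_configs n. 1 + \<beta> / real n * cw_energy n \<sigma>)"
    by (simp only: sum.distrib sum_distrib_left[symmetric] sum_cw_energy) (simp add: card_spin_configs)
  also have "\<dots> \<le> cw_partition \<beta> n"
    unfolding cw_partition_def by (intro sum_mono) (simp only: cw_weight_eq exp_ge_add_one_self)
  finally show ?thesis .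
qed

text \<open>The logarithm of a point mass is affine in the squared total spin, so the entropy is
  computed exactly; the only loss is in replacing the partition function by
  \<open>2 ^ n\<close>.\<close>

lemma shannon_entropy_curie_weiss_ge:
  assumes "n \<ge> 1"
  shows "shannon_entropy (curie_weiss \<beta> n) (\<lambda>\<sigma>. \<sigma>) \<ge>
    real n - \<beta> * (cw_mean \<beta> n (\<lambda>\<sigma>. (total_spin n \<sigma>)\<^sup>2) / real n - 1) / (2 * ln 2)"
proof -
  let ?Z = "cw_partition \<beta> n" and ?E = "cw_mean \<beta> n (\<lambda>\<sigma>. (total_spin n \<sigma>)\<^sup>2)"
  have Z: "?Z > 0" by (rule cw_partition_pos)
  have "(\<Sum>\<sigma>\<in>spin_configs n. measure (curie_weiss \<beta> n) {\<sigma>} * log 2 (measure (curie_weiss \<beta> n) {\<sigma>})) =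
      cw_mean \<beta> n (\<lambda>\<sigma>. \<beta> / (real n * 2 * ln 2) * ((total_spin n \<sigma>)\<^sup>2 + - real n) + - log 2 ?Z)"
    unfolding cw_mean_def sum_divide_distrib
  proof (rule sum.cong[OF refl])
    fix \<sigma> assume \<sigma>: "\<sigma> \<in> spin_configs n"
    have "log 2 (cw_weight \<beta> n \<sigma> / ?Z) = log 2 (cw_weight \<beta> n \<sigma>) - log 2 ?Z"
      using Z cw_weight_pos[of \<beta> n \<sigma>] by (simp add: log_divide)
    also have "log 2 (cw_weight \<beta> n \<sigma>) = \<beta> / (real n * 2 * ln 2) * ((total_spin n \<sigma>)\<^sup>2 + - real n)"
      by (simp add: cw_weight_eq[OF \<sigma>] log_def cw_energy_def)
    finally have l: "log 2 (cw_weight \<beta> n \<sigma> / ?Z) =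
        \<beta> / (real n * 2 * ln 2) * ((total_spin n \<sigma>)\<^sup>2 + - real n) + - log 2 ?Z" by simp
    show "measure (curie_weiss \<beta> n) {\<sigma>} * log 2 (measure (curie_weiss \<beta> n) {\<sigma>}) =
      cw_weight \<beta> n \<sigma> * (\<beta> / (real n * 2 * ln 2) * ((total_spin n \<sigma>)\<^sup>2 + - real n) + - log 2 ?Z) / ?Z"
      unfolding measure_curie_weiss[OF \<sigma>] l by simp
  qed
  also have "\<dots> = \<beta> / (real n * 2 * ln 2) * (?E + - real n) + - log 2 ?Z"
    unfolding cw_mean_add cw_mean_cmult cw_mean_const ..
  also have "\<beta> / (real n * 2 * ln 2) * (?E + - real n) = \<beta> * (?E / real n - 1) / (2 * ln 2)"
    using assms by (simp add: field_simps)
  finally have "shannon_entropy (curie_weiss \<beta> n) (\<lambda>\<sigma>. \<sigma>) = log 2 ?Z - \<beta> * (?E / real n - 1) / (2 * ln 2)"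
    unfolding shannon_entropy_curie_weiss by simp
  moreover have "log 2 ?Z \<ge> log 2 (2 ^ n)"
    using cw_partition_ge[of n \<beta>] Z by (subst log_le_cancel_iff) auto
  ultimately show ?thesis by simp
qed

theorem proposition7p4:
  shows "(\<forall>\<beta>::real. \<beta> < 1 \<longrightarrow>
            (\<exists>C::real. C > 0 \<and>
              (\<forall>\<^sub>F n::nat in sequentially.
                 shannon_entropy (curie_weiss \<beta> n) (\<lambda>\<sigma>. \<sigma>) \<ge> real n - C)))
       \<and> (\<exists>C::real. \<forall>n::nat. n \<ge> 1 \<longrightarrow>
              shannon_entropy (curie_weiss 1 n) (\<lambda>\<sigma>. \<sigma>) \<ge> real n - C * sqrt (real n))"
proof (intro conjI allI impI)
  fix \<beta> :: real assume \<beta>: "\<beta> < 1"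
  \<comment> \<open>One constant for both signs: the fraction serves \<open>\<beta> \<ge> 0\<close>,
    the absolute value serves \<open>\<beta> < 0\<close>.\<close>
  define K where "K = \<bar>\<beta>\<bar> + 2 / (1 - \<beta>)"
  have K: "K > 0" using \<beta> by (auto simp: K_def intro!: add_nonneg_pos)
  have "shannon_entropy (curie_weiss \<beta> n) (\<lambda>\<sigma>. \<sigma>) \<ge> real n - K / (2 * ln 2)" if n: "n \<ge> 1" for n
  proof -
    let ?E = "cw_mean \<beta> n (\<lambda>\<sigma>. (total_spin n \<sigma>)\<^sup>2)"
    have E0: "?E \<ge> 0"
      using cw_mean_mono[of n "\<lambda>_. 0" "\<lambda>\<sigma>. (total_spin n \<sigma>)\<^sup>2" \<beta>] by (simp add: cw_mean_const)
    have "\<beta> * (?E / real n - 1) \<le> K"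
    proof (cases "\<beta> \<ge> 0")
      case True
      have "?E / real n \<le> 2 / (1 - \<beta>)"
        using cw_mean_total_spin_square_high_temperature[OF True \<beta> n] n \<beta> by (simp add: field_simps)
      then have "\<beta> * (?E / real n) \<le> 1 * (2 / (1 - \<beta>))"
        using \<beta> True E0 by (intro mult_mono) auto
      then show ?thesis using True by (simp add: K_def algebra_simps)
    next
      case False
      \<comment> \<open>What is left is \<open>- \<beta>\<close>, which is the absolute value in
        \<open>K\<close>.\<close>
      then have "\<beta> * (?E / real n) \<le> 0" using E0 by (intro mult_nonpos_nonneg) auto
      moreover have "0 \<le> 2 / (1 - \<beta>)" using \<beta> by simp
      ultimately show ?thesis unfolding K_def right_diff_distrib using False by linarith
    qed
    then have "\<beta> * (?E / real n - 1) / (2 * ln 2) \<le> K / (2 * ln 2)"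
      by (intro divide_right_mono) auto
    then show ?thesis using shannon_entropy_curie_weiss_ge[OF n, of \<beta>] by linarith
  qed
  then show "\<exists>C>0. \<forall>\<^sub>F n in sequentially. real n - C \<le> shannon_entropy (curie_weiss \<beta> n) (\<lambda>\<sigma>. \<sigma>)"
    using K by (intro exI[of _ "K / (2 * ln 2)"] conjI eventually_sequentiallyI[of 1]) auto
next
  show "\<exists>C::real. \<forall>n::nat. n \<ge> 1 \<longrightarrow>
      shannon_entropy (curie_weiss 1 n) (\<lambda>\<sigma>. \<sigma>) \<ge> real n - C * sqrt (real n)"
  \<comment> \<open>The 27 comes from \<open>cw_mean_total_spin_square_critical\<close>; the -1 in
    the entropy bound is discarded.\<close>
  proof (intro exI[of _ "27 / (2 * ln 2)"] allI impI)
    fix n :: nat assume n: "n \<ge> 1"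
    let ?E = "cw_mean 1 n (\<lambda>\<sigma>. (total_spin n \<sigma>)\<^sup>2)"
    have "?E / real n \<le> 27 * sqrt (real n)"
      using cw_mean_total_spin_square_critical[OF n] n by (simp add: field_simps)
    then have "1 * (?E / real n - 1) / (2 * ln 2) \<le> 27 * sqrt (real n) / (2 * ln 2)"
      by (intro divide_right_mono) auto
    then show "shannon_entropy (curie_weiss 1 n) (\<lambda>\<sigma>. \<sigma>) \<ge> real n - 27 / (2 * ln 2) * sqrt (real n)"
      using shannon_entropy_curie_weiss_ge[OF n, of 1] by simp
  qed
qed

end
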